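(* Let $r_1,s_1,r_2,s_2\ge2$ be integers, let $\boldsymbol{\lambda}=(\lambda_1,\lambda_2)\in(0,\infty)^2$, and put $h_i=r_i+s_i-1$ for $i\in\{1,2\}$ and $h_*=\min\{h_1,h_2\}$. Then for every $n$, $$\overline{\mathrm{M}}_{\boldsymbol{\lambda}}(n;\mathcal{S}_{r_1,s_1},\mathcal{S}_{r_2,s_2})\ \le\ \min\{\lambda_1B_{h_1}(n),\ \lambda_2B_{h_2}(n)\},$$ where $B_h(n)=\binom{\lfloor n/2\rfloor}{h}+\binom{\lceil n/2\rceil}{h}$. Moreover, the balanced split minimizes the resulting monochromatic count for the internal color: for each $j\in\{1,2\}$, among the two-interval colorings $\chi_{j,x}$ with $0\le x\le n$, the number $N_j(\chi_{j,x};\mathcal{S}_{r_j,s_j})$ is minimized by $x=\lfloor n/2\rfloor$. Therefore $$\pi_{\boldsymbol{\lambda}}(\mathcal{S}_{r_1,s_1},\mathcal{S}_{r_2,s_2})\ \le\ \Bigl(\min_{\{i\in\{1,2\}:\,h_i=h_*\}}\lambda_i\Bigr)\,2^{1-h_*}.$$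
   Context: An ordered graph is a finite graph with a linear order on its vertex set. $\mathcal{K}_n$ is the complete graph on $[n]=\{1,\ldots,n\}$ with the natural order. For integers $r,s\ge1$, $\mathcal{S}_{r,s}$ is the ordered star whose center has $r-1$ leaves to its left (preceding it) and $s-1$ leaves to its right (following it); it has $r+s-1$ vertices, and it is two-sided when $r,s\ge2$. An order-preserving copy of an ordered graph $\mathcal{H}$ in $\mathcal{G}$ is an injective map $V(\mathcal{H})\to V(\mathcal{G})$ that preserves the vertex order and maps every edge of $\mathcal{H}$ to an edge of $\mathcal{G}$; copies are counted by their vertex sets. For ordered graphs $\mathcal{G}_1,\mathcal{G}_2$ and a coloring $\chi:E(\mathcal{K}_n)\to\{1,2\}$, $N_i(\chi;\mathcal{G}_i)$ is the number of order-preserving copies of $\mathcal{G}_i$ in $\mathcal{K}_n$ all of whose edges have color $i$. The weighted ordered multiplicity is $$\overline{\mathrm{M}}_{\boldsymbol{\lambda}}(n;\mathcal{G}_1,\mathcal{G}_2)=\min_{\chi:E(\mathcal{K}_n)\to\{1,2\}}\bigl(\lambda_1N_1(\chi;\mathcal{G}_1)+\lambda_2N_2(\chi;\mathcal{G}_2)\bigr),$$ and $\pi_{\boldsymbol{\lambda}}(\mathcal{G}_1,\mathcal{G}_2)=\lim_{n\to\infty}\overline{\mathrm{M}}_{\boldsymbol{\lambda}}(n;\mathcal{G}_1,\mathcal{G}_2)/\binom{n}{h_*}$, where $h_*$ is the smaller of the numbers of vertices of $\mathcal{G}_1,\mathcal{G}_2$ (the limit exists). For $j\in\{1,2\}$ and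 $0\le x\le n$, the two-interval coloring $\chi_{j,x}$ with internal color $j$ is obtained by splitting $[n]$ into consecutive intervals $A=\{1,\ldots,x\}$ and $B=\{x+1,\ldots,n\}$, giving color $j$ to all edges inside $A$ and all edges inside $B$, and giving the other color to every edge between $A$ and $B$. Convention: $\binom{x}{q}=0$ when $q<0$ or $q>x$. *)

theory Defs
  imports Complex_Main "HOL-Library.FuncSet"
begin

record 'a ograph =
  verts :: "'a set"
  edges :: "'a set set"

definition ordered_graph :: "'a::linorder ograph \<Rightarrow> bool" where
  "ordered_graph G \<longleftrightarrow> finite (verts G) \<and> edges G \<subseteq> {e. e \<subseteq> verts G \<and> card e = 2}"

definition complete_ograph :: "nat \<Rightarrow> nat ograph" where
  "complete_ograph n = \<lparr>verts = {1..n}, edges = {e. e \<subseteq> {1..n} \<and> card e = 2}\<rparr>"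

text \<open>The star is realised on the vertex set 1, ..., r + s - 1. Its center is the vertex r, so that
  r - 1 leaves precede it and s - 1 leaves follow it (for r, s at least 1).\<close>

definition ordered_star :: "nat \<Rightarrow> nat \<Rightarrow> nat ograph" where
  "ordered_star r s =
     \<lparr>verts = {1..r + s - 1}, edges = {{r, v} | v. v \<in> {1..r + s - 1} \<and> v \<noteq> r}\<rparr>"

lemma ordered_graph_complete_ograph: "ordered_graph (complete_ograph n)"
  by (auto simp: ordered_graph_def complete_ograph_def)

lemma ordered_graph_ordered_star: "r \<ge> 1 \<Longrightarrow> s \<ge> 1 \<Longrightarrow> ordered_graph (ordered_star r s)"
  by (auto simp: ordered_graph_def ordered_star_def)

definition order_embedding ::
    "'a::linorder ograph \<Rightarrow> 'b::linorder ograph \<Rightarrow> ('a \<Rightarrow> 'b) \<Rightarrow> bool" where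
  "order_embedding H G f \<longleftrightarrow>
     f ` verts H \<subseteq> verts G \<and> inj_on f (verts H) \<and> strict_mono_on (verts H) f \<and>
     (\<forall>e\<in>edges H. f ` e \<in> edges G)"

text \<open>Colorings are extensional functions (undefined off the edge set), so that there are only
  finitely many of them and the minimum in \<open>ordered_multiplicity\<close> is over a finite nonempty set.\<close>

definition colorings :: "nat \<Rightarrow> (nat set \<Rightarrow> nat) set" where
  "colorings n = edges (complete_ograph n) \<rightarrow>\<^sub>E {1, 2}"

definition mono_copies ::
    "nat \<Rightarrow> (nat set \<Rightarrow> nat) \<Rightarrow> nat \<Rightarrow> 'a::linorder ograph \<Rightarrow> nat set set" where
  "mono_copies n \<chi> i H =
     {f ` verts H | f. order_embedding H (complete_ograph n) f \<and> (\<forall>e\<in>edges H. \<chi> (f ` e) = i)}"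

definition mono_count ::
    "nat \<Rightarrow> (nat set \<Rightarrow> nat) \<Rightarrow> nat \<Rightarrow> 'a::linorder ograph \<Rightarrow> nat" where
  "mono_count n \<chi> i H = card (mono_copies n \<chi> i H)"

text \<open>Weights and graphs are families indexed by the colors 1 and 2; other indices are irrelevant.\<close>

definition ordered_multiplicity ::
    "(nat \<Rightarrow> real) \<Rightarrow> nat \<Rightarrow> (nat \<Rightarrow> 'a::linorder ograph) \<Rightarrow> real" where
  "ordered_multiplicity lam n G =
     Min ((\<lambda>\<chi>. lam 1 * real (mono_count n \<chi> 1 (G 1)) + lam 2 * real (mono_count n \<chi> 2 (G 2)))
            ` colorings n)"

definition multiplicity_ratio ::
    "(nat \<Rightarrow> real) \<Rightarrow> (nat \<Rightarrow> 'a::linorder ograph) \<Rightarrow> nat \<Rightarrow> real" where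
  "multiplicity_ratio lam G n =
     ordered_multiplicity lam n G
       / real (n choose min (card (verts (G 1))) (card (verts (G 2))))"

definition multiplicity_constant :: "(nat \<Rightarrow> real) \<Rightarrow> (nat \<Rightarrow> 'a::linorder ograph) \<Rightarrow> real" where
  "multiplicity_constant lam G = lim (multiplicity_ratio lam G)"

text \<open>For j in {1, 2}, the color other than j is 3 - j.\<close>

definition two_interval_coloring :: "nat \<Rightarrow> nat \<Rightarrow> nat \<Rightarrow> nat set \<Rightarrow> nat" where
  "two_interval_coloring n j x =
     (\<lambda>e \<in> edges (complete_ograph n). if e \<subseteq> {1..x} \<or> e \<subseteq> {x + 1..n} then j else 3 - j)"

lemma two_interval_coloring_in_colorings:
  "j \<in> {1, 2} \<Longrightarrow> two_interval_coloring n j x \<in> colorings n"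
  unfolding two_interval_coloring_def colorings_def by (rule restrict_PiE_iff [THEN iffD2]) auto

definition balanced_binomial :: "nat \<Rightarrow> nat \<Rightarrow> nat" where
  "balanced_binomial h n = (nat \<lfloor>real n / 2\<rfloor> choose h) + (nat \<lceil>real n / 2\<rceil> choose h)"

end

(* A color-j copy of a star in the two-interval coloring lies inside one interval because every leaf
   shares the interval of the center, so these copies are the h-subsets of the two intervals; a
   two-sided star of the other color cannot exist because its center would have to lie in A (to have
   a right neighbor) and in B (to have a left neighbor). Convexity of x choose h makes the
   balanced split optimal. Averaging over vertex deletions gives
   (n + 1) M(n) <= (n + 1 - h) M(n + 1) with h the smaller order, so the ratio is
   nondecreasing even when the two orders differ, and it suffices to bound it at even n, where
   2^h (m choose h) <= (2m choose h) applies. *)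

theory Submission imports Defs begin

section \<open>Convexity and growth of binomial coefficients\<close>

text \<open>Discrete convexity: for \<open>h > 0\<close>, raising the upper index from
  \<open>x\<close> to \<open>x + 1\<close> adds \<open>x choose (h - 1)\<close>, which is
  nondecreasing in \<open>x\<close>. Hence adding \<open>d\<close> to the larger index gains at
  least as much as adding it to the smaller one.\<close>

lemma binomial_sum_shift_le:
  fixes a b d h :: nat
  assumes "a \<le> b"
  shows "((a + d) choose h) + (b choose h) \<le> (a choose h) + ((b + d) choose h)"
proof (induction d)
  case (Suc d)
  show ?case
  proof (cases h)
    case (Suc k)
    have "(a + d) choose k \<le> (b + d) choose k"
      using assms by (intro binomial_right_mono) auto
    with Suc.IH Suc show ?thesis by simp
  qed simp
qed simp

text \<open>A split with smaller part \<open>a\<close> arises from the balanced one by moving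
  \<open>n div 2 - a\<close> units from the smaller part to the larger; by convexity this cannot
  decrease the sum.\<close>

lemma binomial_balanced_le:
  fixes n x h :: nat
  assumes "x \<le> n"
  shows "((n div 2) choose h) + ((n - n div 2) choose h) \<le> (x choose h) + ((n - x) choose h)"
proof -
  have *: "((n div 2) choose h) + ((n - n div 2) choose h) \<le> (a choose h) + ((n - a) choose h)"
    if "a \<le> n div 2" for a
  proof -
    have "((a + (n div 2 - a)) choose h) + ((n - n div 2) choose h)
        \<le> (a choose h) + ((n - n div 2 + (n div 2 - a)) choose h)"
      using that by (intro binomial_sum_shift_le) linarith
    moreover have "n - n div 2 + (n div 2 - a) = n - a" using that by linarith
    ultimately show ?thesis using that by simp
  qed
  show ?thesis
  proof (cases "x \<le> n div 2")
    case False
    \<comment> \<open>The sum is symmetric under exchanging \<open>x\<close> and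
      \<open>n - x\<close>, so the smaller part can play the role of \<open>a\<close>.\<close>
    then have "n - x \<le> n div 2" by linarith
    from *[OF this] assms show ?thesis by simp
  qed (rule *)
qed

text \<open>For \<open>n > 0\<close> both sides equal \<open>n * ((n - 1) choose k)\<close>. The
  truncated subtraction is consistent: for \<open>k \<ge> n\<close> both sides vanish.\<close>

lemma Suc_times_binomial_Suc: "Suc k * (n choose Suc k) = (n - k) * (n choose k)"
proof (cases n)
  case (Suc m)
  then show ?thesis
    using Suc_times_binomial[of k m] binomial_absorb_comp[of n k] by simp
qed simp

text \<open>Passing from \<open>h\<close> to \<open>Suc h\<close> multiplies the left side by
  \<open>2 * (m - h) / Suc h\<close> and the right side by \<open>(2 * m - h) / Suc h\<close>, which
  is at least as large. Multiplying through by \<open>Suc h\<close> keeps the argument in the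
  natural numbers.\<close>

lemma power_two_times_binomial_le: "2 ^ h * (m choose h) \<le> (2 * m) choose h"
proof (induction h)
  case (Suc h)
  have "Suc h * (2 ^ Suc h * (m choose Suc h)) = 2 ^ Suc h * (Suc h * (m choose Suc h))"
    by (simp only: mult.left_commute)
  also have "\<dots> = (2 * (m - h)) * (2 ^ h * (m choose h))"
    unfolding Suc_times_binomial_Suc by (simp add: mult_ac)
  also have "\<dots> \<le> (2 * m - h) * ((2 * m) choose h)"
    using Suc.IH by (intro mult_mono) auto
  also have "\<dots> = Suc h * ((2 * m) choose Suc h)"
    by (rule Suc_times_binomial_Suc [symmetric])
  finally show ?case by (simp only: Suc_mult_le_cancel1)
qed simp

lemma balanced_binomial_eq:
  "balanced_binomial h n = ((n div 2) choose h) + ((n - n div 2) choose h)"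
proof -
  have "nat \<lfloor>real n / 2\<rfloor> = n div 2" by linarith
  moreover have "nat \<lceil>real n / 2\<rceil> = n - n div 2" by linarith
  ultimately show ?thesis by (simp add: balanced_binomial_def)
qed

section \<open>Copies, colorings and the minimum over colorings\<close>

text \<open>Supplies an order embedding of a star onto any prescribed vertex set of the right
  size.\<close>

lemma ex_strict_mono_on_enumeration:
  fixes X :: "'a::linorder set"
  assumes "finite X"
  shows "\<exists>f. strict_mono_on {1..card X} f \<and> f ` {1..card X} = X"
proof -
  \<comment> \<open>Star vertices are counted from 1, list positions from 0.\<close>
  define f where "f i = sorted_list_of_set X ! (i - 1)" for i
  have "strict_mono_on {1..card X} f"
  proof (rule strict_mono_onI)
    fix i j assume "i \<in> {1..card X}" "j \<in> {1..card X}" "i < j"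
    then show "f i < f j"
      unfolding f_def
      by (intro sorted_wrt_nth_less[OF strict_sorted_list_of_set]) auto
  qed
  moreover have "f ` {1..card X} = X"
  proof -
    have "{1..card X} = Suc ` {..<card X}" by (simp add: image_Suc_lessThan)
    then have "f ` {1..card X} = (!) (sorted_list_of_set X) ` {..<length (sorted_list_of_set X)}"
      by (simp add: image_image f_def)
    also have "\<dots> = set (sorted_list_of_set X)"
      by (auto simp: set_conv_nth)
    finally show ?thesis using assms by simp
  qed
  ultimately show ?thesis by blast
qed

lemma mono_copies_subset:
  "mono_copies n \<chi> i H \<subseteq> {X. X \<subseteq> {1..n} \<and> card X = card (verts H)}"
  by (auto simp: mono_copies_def order_embedding_def complete_ograph_def card_image)

lemma finite_mono_copies: "finite (mono_copies n \<chi> i H)"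
  by (rule finite_subset[OF mono_copies_subset]) simp

lemma finite_colorings: "finite (colorings n)"
  unfolding colorings_def complete_ograph_def by (intro finite_PiE) auto

lemma colorings_nonempty: "colorings n \<noteq> {}"
  using two_interval_coloring_in_colorings[of 1] by blast

lemma ordered_multiplicity_le:
  assumes "\<chi> \<in> colorings n"
  shows "ordered_multiplicity lam n G
    \<le> lam 1 * real (mono_count n \<chi> 1 (G 1)) + lam 2 * real (mono_count n \<chi> 2 (G 2))"
  unfolding ordered_multiplicity_def using assms finite_colorings by (intro Min_le) auto

lemma ordered_multiplicity_attained:
  obtains \<chi> where "\<chi> \<in> colorings n"
    "ordered_multiplicity lam n G
      = lam 1 * real (mono_count n \<chi> 1 (G 1)) + lam 2 * real (mono_count n \<chi> 2 (G 2))"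
proof -
  have "ordered_multiplicity lam n G \<in>
    (\<lambda>\<chi>. lam 1 * real (mono_count n \<chi> 1 (G 1)) + lam 2 * real (mono_count n \<chi> 2 (G 2)))
      ` colorings n"
    unfolding ordered_multiplicity_def
    using finite_colorings colorings_nonempty by (intro Min_in) auto
  then show thesis using that by blast
qed

section \<open>Monochromatic stars in two-interval colorings\<close>

lemma two_interval_coloring_edge:
  assumes "1 \<le> a" "a < b" "b \<le> n"
  shows "two_interval_coloring n j x {a, b} = (if b \<le> x \<or> x < a then j else 3 - j)"
  using assms by (auto simp: two_interval_coloring_def complete_ograph_def)

lemma two_interval_coloring_edge_iff:
  assumes "j \<in> {1, 2}" "1 \<le> a" "a < b" "b \<le> n"
  shows "two_interval_coloring n j x {a, b} = j \<longleftrightarrow> b \<le> x \<or> x < a"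
    and "two_interval_coloring n j x {a, b} = 3 - j \<longleftrightarrow> a \<le> x \<and> x < b"
proof -
  have "j \<noteq> 3 - j" using assms(1) by auto
  then show "two_interval_coloring n j x {a, b} = j \<longleftrightarrow> b \<le> x \<or> x < a"
    and "two_interval_coloring n j x {a, b} = 3 - j \<longleftrightarrow> a \<le> x \<and> x < b"
    unfolding two_interval_coloring_edge[OF assms(2-4)] using assms(3) by auto
qed

lemma star_embedding_edge_color:
  assumes "order_embedding (ordered_star r s) (complete_ograph n) f"
    and "\<forall>e\<in>edges (ordered_star r s). \<chi> (f ` e) = i"
    and "v \<in> {1..r + s - 1}" "v \<noteq> r"
  shows "\<chi> {f r, f v} = i"
proof -
  have "{r, v} \<in> edges (ordered_star r s)"
    using assms(3,4) by (auto simp: ordered_star_def)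
  with assms(2) have "\<chi> (f ` {r, v}) = i" by blast
  then show ?thesis by simp
qed

text \<open>Every edge of the star contains the center, so color \<open>j\<close> forces each leaf
  into the interval of the center. Conversely, all pairs inside one interval have color
  \<open>j\<close>, so the increasing enumeration of any subset of the right size is a copy.\<close>

lemma mono_copies_two_interval_internal:
  assumes rs: "r \<ge> 1" "s \<ge> 1" and j: "j \<in> {1, 2}" and x: "x \<le> n"
  shows "mono_copies n (two_interval_coloring n j x) j (ordered_star r s) =
    {X. X \<subseteq> {1..x} \<and> card X = r + s - 1} \<union> {X. X \<subseteq> {x + 1..n} \<and> card X = r + s - 1}"
    (is "?L = ?R")
proof
  let ?h = "r + s - 1" and ?\<chi> = "two_interval_coloring n j x"
  have V: "verts (ordered_star r s) = {1..?h}" by (simp add: ordered_star_def)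
  show "?L \<subseteq> ?R"
  proof
    fix X assume X: "X \<in> ?L"
    then obtain f where f: "order_embedding (ordered_star r s) (complete_ograph n) f"
      and col: "\<forall>e\<in>edges (ordered_star r s). ?\<chi> (f ` e) = j" and Xf: "X = f ` {1..?h}"
      by (auto simp: mono_copies_def V)
    have cX: "card X = ?h" using mono_copies_subset X by (fastforce simp: V)
    have rng: "1 \<le> f v" "f v \<le> n" if "v \<in> {1..?h}" for v
      using f that by (simp_all add: order_embedding_def V complete_ograph_def image_subset_iff)
    have inj: "inj_on f {1..?h}" using f by (simp add: order_embedding_def V)
    have r: "r \<in> {1..?h}" using rs by auto
    have same: "f v \<le> x \<longleftrightarrow> f r \<le> x" if v: "v \<in> {1..?h}" for v
    proof (cases "v = r")
      case False
      have c: "?\<chi> {f r, f v} = j" by (rule star_embedding_edge_color[OF f col v False])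
      have "f v \<noteq> f r" using inj v r False by (auto dest: inj_onD)
      then consider "f v < f r" | "f r < f v" by linarith
      then show ?thesis
      proof cases
        case 1
        \<comment> \<open>The edge is written with the center first, whereas the color rule expects
          the smaller endpoint first.\<close>
        from c two_interval_coloring_edge_iff(1)[OF j rng(1)[OF v] 1 rng(2)[OF r]]
        have "f r \<le> x \<or> x < f v" by (simp add: insert_commute)
        with 1 show ?thesis by linarith
      next
        case 2
        from c two_interval_coloring_edge_iff(1)[OF j rng(1)[OF r] 2 rng(2)[OF v]]
        have "f v \<le> x \<or> x < f r" by simp
        with 2 show ?thesis by linarith
      qed
    qed simp
    have "X \<subseteq> {1..x} \<or> X \<subseteq> {x + 1..n}"
    proof (cases "f r \<le> x")
      case True
      then have "X \<subseteq> {1..x}" unfolding Xf using same rng(1) by (auto simp: image_subset_iff)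
      then show ?thesis ..
    next
      case False
      then have "x + 1 \<le> f v" if "v \<in> {1..?h}" for v using same[OF that] by linarith
      then have "X \<subseteq> {x + 1..n}" unfolding Xf using rng(2) by (auto simp: image_subset_iff)
      then show ?thesis ..
    qed
    with cX show "X \<in> ?R" by auto
  qed
  show "?R \<subseteq> ?L"
  proof
    fix X assume X: "X \<in> ?R"
    then have cX: "card X = ?h" and sub: "X \<subseteq> {1..x} \<or> X \<subseteq> {x + 1..n}" by auto
    then have Xn: "X \<subseteq> {1..n}" using x by auto
    then have "finite X" by (rule finite_subset) simp
    from ex_strict_mono_on_enumeration[OF this] obtain f
      where f: "strict_mono_on {1..?h} f" "f ` {1..?h} = X" unfolding cX by blast
    have inj: "inj_on f {1..?h}" using f(1) by (rule strict_mono_on_imp_inj_on)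
    have E: "f ` e \<subseteq> X \<and> card (f ` e) = 2" if "e \<in> edges (ordered_star r s)" for e
    proof -
      have "e \<subseteq> {1..?h}" "card e = 2"
        using that ordered_graph_ordered_star[OF rs] by (auto simp: ordered_graph_def V)
      then show ?thesis using inj f(2) by (auto simp: card_image inj_on_subset)
    qed
    then have emb: "order_embedding (ordered_star r s) (complete_ograph n) f"
      using f inj Xn by (auto simp: order_embedding_def V complete_ograph_def)
    have "?\<chi> (f ` e) = j" if "e \<in> edges (ordered_star r s)" for e
    proof -
      have "f ` e \<subseteq> {1..x} \<or> f ` e \<subseteq> {x + 1..n}" using E[OF that] sub by blast
      moreover have "f ` e \<in> edges (complete_ograph n)"
        using emb that by (simp add: order_embedding_def)
      ultimately show ?thesis by (simp add: two_interval_coloring_def)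
    qed
    with emb f(2) show "X \<in> ?L" unfolding mono_copies_def V by blast
  qed
qed

lemma mono_count_two_interval_internal:
  assumes "r \<ge> 1" "s \<ge> 1" "j \<in> {1, 2}" "x \<le> n"
  shows "mono_count n (two_interval_coloring n j x) j (ordered_star r s) =
    (x choose (r + s - 1)) + ((n - x) choose (r + s - 1))"
proof -
  let ?h = "r + s - 1"
  let ?A = "{X. X \<subseteq> {1..x} \<and> card X = ?h}" and ?B = "{X. X \<subseteq> {x + 1..n} \<and> card X = ?h}"
  have "{1..x} \<inter> {x + 1..n} = {}" by auto
  \<comment> \<open>A set in both families lies in the empty intersection of the intervals, and the
    empty set is excluded because \<open>?h \<ge> 1\<close>.\<close>
  then have "X = {}" if "X \<in> ?A \<inter> ?B" for X using that by blast
  moreover have "{} \<notin> ?A" using assms(1,2) by simp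
  ultimately have "?A \<inter> ?B = {}" by blast
  then have "card (?A \<union> ?B) = card ?A + card ?B" by (intro card_Un_disjoint) auto
  then show ?thesis
    using assms by (simp add: mono_count_def mono_copies_two_interval_internal n_subsets)
qed

text \<open>An edge of color \<open>3 - j\<close> crosses the split. A leaf on the left therefore
  puts the center to the right of \<open>x\<close>, while a leaf on the right puts it at or below
  \<open>x\<close>.\<close>

lemma mono_count_two_interval_external:
  assumes rs: "r \<ge> 2" "s \<ge> 2" and j: "j \<in> {1, 2}"
  shows "mono_count n (two_interval_coloring n j x) (3 - j) (ordered_star r s) = 0"
proof -
  let ?h = "r + s - 1" and ?\<chi> = "two_interval_coloring n j x"
  have False if f: "order_embedding (ordered_star r s) (complete_ograph n) f"
    and col: "\<forall>e\<in>edges (ordered_star r s). ?\<chi> (f ` e) = 3 - j" for f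
  proof -
    have rng: "1 \<le> f v" "f v \<le> n" if "v \<in> {1..?h}" for v
      using f that
      by (simp_all add: order_embedding_def ordered_star_def complete_ograph_def image_subset_iff)
    have mono: "f u < f v" if "u \<in> {1..?h}" "v \<in> {1..?h}" "u < v" for u v
    proof -
      have "strict_mono_on {1..?h} f" using f by (simp add: order_embedding_def ordered_star_def)
      then show ?thesis by (rule strict_mono_onD[OF _ that])
    qed
    \<comment> \<open>The witnesses are the extreme leaves: \<open>r \<ge> 2\<close> and
      \<open>s \<ge> 2\<close> give \<open>1 < r\<close> and \<open>r < ?h\<close>.\<close>
    have in1: "1 \<in> {1..?h}" and inr: "r \<in> {1..?h}" and inh: "?h \<in> {1..?h}" using rs by auto
    have "?\<chi> {f r, f 1} = 3 - j"
      using rs by (intro star_embedding_edge_color[OF f col in1]) auto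
    moreover have lt1: "f 1 < f r" using rs by (intro mono[OF in1 inr]) auto
    ultimately have "x < f r"
      using two_interval_coloring_edge_iff(2)[OF j rng(1)[OF in1] _ rng(2)[OF inr]]
      by (simp add: insert_commute)
    moreover have "?\<chi> {f r, f ?h} = 3 - j"
      using rs by (intro star_embedding_edge_color[OF f col inh]) auto
    moreover have "f r < f ?h" using rs by (intro mono[OF inr inh]) auto
    ultimately show False
      using two_interval_coloring_edge_iff(2)[OF j rng(1)[OF inr] _ rng(2)[OF inh]] by simp
  qed
  then have "mono_copies n ?\<chi> (3 - j) (ordered_star r s) = {}"
    unfolding mono_copies_def by blast
  then show ?thesis by (simp add: mono_count_def)
qed

section \<open>Vertex deletion and monotonicity of the ratio\<close>

text \<open>For \<open>v\<close> in \<open>{1..Suc n}\<close> this restricts to the increasing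
  bijection from \<open>{1..n}\<close> onto \<open>{1..Suc n} - {v}\<close>, which relabels the
  vertices that remain after deleting \<open>v\<close>.\<close>

definition skip :: "nat \<Rightarrow> nat \<Rightarrow> nat" where
  "skip v k = (if k < v then k else Suc k)"

lemma strict_mono_skip: "strict_mono (skip v)"
  by (rule strict_monoI) (auto simp: skip_def)

lemma inj_skip: "inj (skip v)"
  by (rule strict_mono_imp_inj_on[OF strict_mono_skip])

lemma skip_neq: "skip v k \<noteq> v"
  by (auto simp: skip_def)

lemma skip_image_edge:
  assumes "e \<in> edges (complete_ograph n)"
  shows "skip v ` e \<in> edges (complete_ograph (Suc n))"
proof -
  have "card (skip v ` e) = card e" by (rule card_image[OF inj_on_subset[OF inj_skip]]) simp
  moreover have "skip v ` e \<subseteq> {1..Suc n}"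
    using assms by (force simp: complete_ograph_def skip_def)
  ultimately show ?thesis using assms by (simp add: complete_ograph_def)
qed

text \<open>The coloring inherited after deleting \<open>v\<close>, pulled back to
  \<open>{1..n}\<close>. Restricting it to the edge set keeps it extensional, as membership in
  \<open>colorings n\<close> demands.\<close>

definition delete_vertex :: "nat \<Rightarrow> nat \<Rightarrow> (nat set \<Rightarrow> nat) \<Rightarrow> nat set \<Rightarrow> nat" where
  "delete_vertex n v \<chi> = (\<lambda>e\<in>edges (complete_ograph n). \<chi> (skip v ` e))"

lemma delete_vertex_in_colorings:
  assumes "\<chi> \<in> colorings (Suc n)"
  shows "delete_vertex n v \<chi> \<in> colorings n"
  using assms skip_image_edge unfolding colorings_def delete_vertex_def
  by (intro restrict_PiE_iff [THEN iffD2] ballI) (blast dest: PiE_mem)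

text \<open>Composing a copy with \<open>skip v\<close> yields a copy of the same color that avoids
  \<open>v\<close>, and distinct vertex sets stay distinct.\<close>

lemma mono_count_delete_vertex_le:
  "mono_count n (delete_vertex n v \<chi>) i H \<le> card {X \<in> mono_copies (Suc n) \<chi> i H. v \<notin> X}"
proof -
  have "(`) (skip v) ` mono_copies n (delete_vertex n v \<chi>) i H
      \<subseteq> {X \<in> mono_copies (Suc n) \<chi> i H. v \<notin> X}"
  proof safe
    fix X assume "X \<in> mono_copies n (delete_vertex n v \<chi>) i H"
    then obtain f where f: "order_embedding H (complete_ograph n) f"
      and col: "\<forall>e\<in>edges H. delete_vertex n v \<chi> (f ` e) = i" and X: "X = f ` verts H"
      by (auto simp: mono_copies_def)
    have sm: "strict_mono_on (verts H) (skip v \<circ> f)"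
      using f strict_mono_skip
      by (auto simp: order_embedding_def strict_mono_on_def strict_mono_def)
    have "f ` verts H \<subseteq> {1..n}" using f by (simp add: order_embedding_def complete_ograph_def)
    then have "(skip v \<circ> f) ` verts H \<subseteq> {1..Suc n}" by (force simp: skip_def)
    moreover have fe: "f ` e \<in> edges (complete_ograph n)" if "e \<in> edges H" for e
      using f that by (simp add: order_embedding_def)
    moreover have "(skip v \<circ> f) ` e \<in> edges (complete_ograph (Suc n))" if "e \<in> edges H" for e
      using skip_image_edge[OF fe[OF that]] by (simp only: image_comp)
    ultimately have "order_embedding H (complete_ograph (Suc n)) (skip v \<circ> f)"
      using sm strict_mono_on_imp_inj_on[OF sm]
      unfolding order_embedding_def by (simp add: complete_ograph_def)
    \<comment> \<open>By \<open>fe\<close> the restricted coloring is only evaluated on genuine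
      edges, so the value \<open>undefined\<close> never occurs.\<close>
    moreover have "\<forall>e\<in>edges H. \<chi> ((skip v \<circ> f) ` e) = i"
      using col fe by (simp add: delete_vertex_def image_image)
    moreover have "skip v ` X = (skip v \<circ> f) ` verts H" by (simp add: X image_comp)
    ultimately show "skip v ` X \<in> mono_copies (Suc n) \<chi> i H"
      unfolding mono_copies_def by blast
  qed (auto simp: skip_neq [symmetric])
  moreover have "inj_on ((`) (skip v)) A" for A
    using inj_skip by (simp add: inj_on_def inj_image_eq_iff)
  ultimately show ?thesis
    unfolding mono_count_def by (intro card_inj_on_le) (auto simp: finite_mono_copies)
qed

text \<open>The truncated subtraction is harmless: if \<open>card (verts H) > n + 1\<close> there are no copies.\<close>

lemma sum_mono_count_delete_vertex_le:
  "(\<Sum>v\<in>{1..Suc n}. mono_count n (delete_vertex n v \<chi>) i H)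
    \<le> (Suc n - card (verts H)) * mono_count (Suc n) \<chi> i H"
proof -
  let ?C = "mono_copies (Suc n) \<chi> i H"
  have "(\<Sum>v\<in>{1..Suc n}. mono_count n (delete_vertex n v \<chi>) i H)
      \<le> (\<Sum>v\<in>{1..Suc n}. card {X \<in> ?C. v \<notin> X})"
    by (intro sum_mono mono_count_delete_vertex_le)
  \<comment> \<open>Double counting of pairs of a copy and a vertex outside it.\<close>
  also have "\<dots> = (\<Sum>X\<in>?C. card {v \<in> {1..Suc n}. v \<notin> X})"
    by (rule sum_multicount_gen) (auto simp: finite_mono_copies)
  also have "\<dots> = (\<Sum>X\<in>?C. Suc n - card (verts H))"
  proof (rule sum.cong)
    fix X assume "X \<in> ?C"
    then have X: "X \<subseteq> {1..Suc n}" "card X = card (verts H)"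
      using mono_copies_subset[of "Suc n" \<chi> i H] by auto
    have "{v \<in> {1..Suc n}. v \<notin> X} = {1..Suc n} - X" by auto
    then show "card {v \<in> {1..Suc n}. v \<notin> X} = Suc n - card (verts H)"
      using X by (simp add: card_Diff_subset finite_subset)
  qed simp
  finally show ?thesis by (simp add: mono_count_def mult.commute)
qed

text \<open>Take an optimal coloring on \<open>Suc n\<close> vertices. Each of its
  \<open>Suc n\<close> vertex deletions competes in the minimum for \<open>n\<close>, and summing
  over the deletions counts every copy at most \<open>Suc n - h\<close> times.\<close>

lemma ordered_multiplicity_Suc_ge:
  fixes G :: "nat \<Rightarrow> 'a::linorder ograph"
  assumes "lam 1 \<ge> 0" "lam 2 \<ge> 0"
    and h: "h = min (card (verts (G 1))) (card (verts (G 2)))"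
  shows "real (Suc n) * ordered_multiplicity lam n G
    \<le> real (Suc n - h) * ordered_multiplicity lam (Suc n) G"
proof -
  obtain \<chi> where \<chi>: "\<chi> \<in> colorings (Suc n)" and M: "ordered_multiplicity lam (Suc n) G
      = lam 1 * real (mono_count (Suc n) \<chi> 1 (G 1)) + lam 2 * real (mono_count (Suc n) \<chi> 2 (G 2))"
    by (rule ordered_multiplicity_attained)
  let ?N = "\<lambda>v i. mono_count n (delete_vertex n v \<chi>) i (G i)"
  have N: "real (\<Sum>v\<in>{1..Suc n}. ?N v i) \<le> real (Suc n - h) * real (mono_count (Suc n) \<chi> i (G i))"
    if "i \<in> {1, 2}" for i
  proof -
    have "(\<Sum>v\<in>{1..Suc n}. ?N v i) \<le> (Suc n - card (verts (G i))) * mono_count (Suc n) \<chi> i (G i)"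
      by (rule sum_mono_count_delete_vertex_le)
    \<comment> \<open>The smaller order gives one factor valid for both colors, even when the two
      orders differ.\<close>
    also have "\<dots> \<le> (Suc n - h) * mono_count (Suc n) \<chi> i (G i)"
      using that h by (intro mult_right_mono) auto
    finally show ?thesis by (simp only: of_nat_mult [symmetric] of_nat_le_iff)
  qed
  have "real (Suc n) * ordered_multiplicity lam n G
      = (\<Sum>v\<in>{1..Suc n}. ordered_multiplicity lam n G)" by simp
  also have "\<dots> \<le> (\<Sum>v\<in>{1..Suc n}. lam 1 * real (?N v 1) + lam 2 * real (?N v 2))"
    by (intro sum_mono ordered_multiplicity_le delete_vertex_in_colorings \<chi>)
  also have "\<dots> = lam 1 * real (\<Sum>v\<in>{1..Suc n}. ?N v 1) + lam 2 * real (\<Sum>v\<in>{1..Suc n}. ?N v 2)"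
    by (simp only: sum.distrib sum_distrib_left of_nat_sum)
  also have "\<dots> \<le> lam 1 * (real (Suc n - h) * real (mono_count (Suc n) \<chi> 1 (G 1)))
      + lam 2 * (real (Suc n - h) * real (mono_count (Suc n) \<chi> 2 (G 2)))"
    using N[of 1] N[of 2] assms(1,2) by (intro add_mono mult_left_mono) auto
  also have "\<dots> = real (Suc n - h) * ordered_multiplicity lam (Suc n) G"
    by (simp add: M algebra_simps)
  finally show ?thesis .
qed

lemma ordered_multiplicity_nonneg:
  assumes "lam 1 \<ge> 0" "lam 2 \<ge> 0"
  shows "ordered_multiplicity lam n G \<ge> 0"
  using assms by (metis ordered_multiplicity_attained add_nonneg_nonneg mult_nonneg_nonneg
      of_nat_0_le_iff)

text \<open>For \<open>h \<le> n\<close> the averaging factor \<open>(Suc n - h) / Suc n\<close> is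
  exactly \<open>(n choose h) / (Suc n choose h)\<close>, so normalizing by the binomial coefficient
  absorbs it.\<close>

lemma incseq_multiplicity_ratio:
  fixes G :: "nat \<Rightarrow> 'a::linorder ograph"
  assumes "lam 1 \<ge> 0" "lam 2 \<ge> 0"
  shows "incseq (multiplicity_ratio lam G)"
proof (rule incseq_SucI)
  fix n
  define h where "h = min (card (verts (G 1))) (card (verts (G 2)))"
  let ?M = "\<lambda>n. ordered_multiplicity lam n G"
  have ratio: "multiplicity_ratio lam G n = ?M n / real (n choose h)" for n
    by (simp add: multiplicity_ratio_def h_def)
  show "multiplicity_ratio lam G n \<le> multiplicity_ratio lam G (Suc n)"
  proof (cases "h \<le> n")
    case False
    \<comment> \<open>Here \<open>n choose h\<close> is 0 and division by 0 gives 0, so it suffices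
      that the next ratio is nonnegative.\<close>
    have "?M (Suc n) \<ge> 0" by (rule ordered_multiplicity_nonneg[OF assms])
    with False show ?thesis by (simp add: ratio binomial_eq_0)
  next
    case True
    have pos: "0 < real (n choose h)" "0 < real (Suc n choose h)" "0 < real (Suc n - h)"
      using True by (auto simp: zero_less_binomial_iff)
    have bin: "real (Suc n - h) * real (Suc n choose h) = real (Suc n) * real (n choose h)"
      using binomial_absorb_comp[of "Suc n" h] by (simp only: of_nat_mult [symmetric]) simp
    \<comment> \<open>The desired inequality in cross-multiplied form, with the positive factor
      \<open>Suc n - h\<close> still to be cancelled.\<close>
    have "real (Suc n - h) * (?M n * real (Suc n choose h)) = real (Suc n) * ?M n * real (n choose h)"
      using bin by (simp only: mult_ac)
    also have "\<dots> \<le> real (Suc n - h) * ?M (Suc n) * real (n choose h)"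
      using ordered_multiplicity_Suc_ge[OF assms h_def, of n]
      by (intro mult_right_mono) auto
    also have "\<dots> = real (Suc n - h) * (?M (Suc n) * real (n choose h))" by (simp only: mult_ac)
    finally have "?M n * real (Suc n choose h) \<le> ?M (Suc n) * real (n choose h)"
      using pos(3) by (simp only: mult_le_cancel_left_pos)
    then show ?thesis unfolding ratio using pos(1,2)
      by (simp only: divide_le_eq le_divide_eq times_divide_eq_left times_divide_eq_right
          if_True if_False)
  qed
qed

section \<open>Upper bounds for two-sided stars\<close>

text \<open>The balanced two-interval coloring with internal color \<open>j\<close> is the witness:
  its other color contributes nothing, because that color's star is two-sided.\<close>

lemma ordered_multiplicity_star_le:
  assumes "\<forall>i\<in>{1, 2}. r i \<ge> 2 \<and> s i \<ge> 2" and "\<forall>i\<in>{1, 2}. S i = ordered_star (r i) (s i)"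
    and j: "j \<in> {1, 2}"
  shows "ordered_multiplicity lam n S \<le> lam j * real (balanced_binomial (r j + s j - 1) n)"
proof -
  let ?\<chi> = "two_interval_coloring n j (n div 2)"
  have i: "mono_count n ?\<chi> j (S j) = balanced_binomial (r j + s j - 1) n"
    using assms mono_count_two_interval_internal[of "r j" "s j" j "n div 2" n]
    by (auto simp: balanced_binomial_eq)
  have e: "mono_count n ?\<chi> (3 - j) (S (3 - j)) = 0"
  proof -
    have "3 - j \<in> {1, 2}" using j by auto
    then show ?thesis
      using assms mono_count_two_interval_external[of "r (3 - j)" "s (3 - j)" j] by metis
  qed
  have "ordered_multiplicity lam n S
      \<le> lam 1 * real (mono_count n ?\<chi> 1 (S 1)) + lam 2 * real (mono_count n ?\<chi> 2 (S 2))"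
    using j by (intro ordered_multiplicity_le two_interval_coloring_in_colorings)
  also have "\<dots> = lam j * real (mono_count n ?\<chi> j (S j))"
    using j e by auto
  finally show ?thesis by (simp add: i)
qed

text \<open>At an even order both halves have size \<open>m\<close>, so the numerator is
  \<open>2 * (m choose h)\<close>, and the power-of-two inequality bounds the quotient by
  \<open>2 / 2 ^ h\<close>.\<close>

lemma balanced_binomial_ratio_even_le:
  "real (balanced_binomial h (2 * m)) / real ((2 * m) choose h) \<le> 2 powi (1 - int h)"
proof -
  have "2 ^ h * real (m choose h) \<le> real ((2 * m) choose h)"
    using of_nat_mono[OF power_two_times_binomial_le[of h m], where ?'a = real] by simp
  \<comment> \<open>The case split covers a zero denominator, where the quotient is 0.\<close>
  then have "real (balanced_binomial h (2 * m)) / real ((2 * m) choose h) \<le> 2 / 2 ^ h"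
    by (cases "real ((2 * m) choose h) = 0")
      (simp_all add: balanced_binomial_eq divide_simps mult_ac del: of_nat_eq_0_iff)
  also have "(2::real) / 2 ^ h = 2 powi (1 - int h)"
    by (simp add: power_int_diff)
  finally show ?thesis .
qed

theorem theorem3p3:
  fixes r s h :: "nat \<Rightarrow> nat" and lam :: "nat \<Rightarrow> real" and hmin :: nat
    and S :: "nat \<Rightarrow> nat ograph"
  assumes "\<forall>i\<in>{1, 2}. r i \<ge> 2 \<and> s i \<ge> 2"
    and "\<forall>i\<in>{1, 2}. lam i > 0"
    and "\<forall>i\<in>{1, 2}. h i = r i + s i - 1"
    and "hmin = min (h 1) (h 2)"
    and "\<forall>i\<in>{1, 2}. S i = ordered_star (r i) (s i)"
  shows "(\<forall>n. ordered_multiplicity lam n S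
               \<le> min (lam 1 * real (balanced_binomial (h 1) n))
                     (lam 2 * real (balanced_binomial (h 2) n)))
       \<and> (\<forall>n. \<forall>j\<in>{1, 2}.
             is_arg_min (\<lambda>x. mono_count n (two_interval_coloring n j x) j (S j))
               (\<lambda>x. x \<le> n) (nat \<lfloor>real n / 2\<rfloor>))
       \<and> convergent (multiplicity_ratio lam S)
       \<and> multiplicity_constant lam S
           \<le> Min (lam ` {i \<in> {1, 2}. h i = hmin}) * 2 powi (1 - int hmin)"
proof -
  have hmin: "min (card (verts (S 1))) (card (verts (S 2))) = hmin"
    using assms(3-5) by (simp add: ordered_star_def)
  have le: "ordered_multiplicity lam n S \<le> lam j * real (balanced_binomial (h j) n)"
    if "j \<in> {1, 2}" for n j
  proof -
    have "h j = r j + s j - 1" using assms(3) that by blast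
    then show ?thesis using ordered_multiplicity_star_le[OF assms(1,5) that] by simp
  qed
  have arg: "is_arg_min (\<lambda>x. mono_count n (two_interval_coloring n j x) j (S j))
      (\<lambda>x. x \<le> n) (nat \<lfloor>real n / 2\<rfloor>)" if j: "j \<in> {1, 2}" for n j
  proof -
    have half: "nat \<lfloor>real n / 2\<rfloor> = n div 2" by linarith
    have count: "mono_count n (two_interval_coloring n j x) j (S j)
        = (x choose (h j)) + ((n - x) choose (h j))" if "x \<le> n" for x
      using mono_count_two_interval_internal[of "r j" "s j" j x n] that j assms by auto
    show ?thesis
      unfolding half is_arg_min_linorder
      using binomial_balanced_le[of _ n "h j"] by (simp add: count)
  qed
  have inc: "incseq (multiplicity_ratio lam S)"
    using assms(2) by (intro incseq_multiplicity_ratio) (auto simp: less_imp_le)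
  let ?I = "{i \<in> {1, 2}. h i = hmin}"
  let ?b = "Min (lam ` ?I) * 2 powi (1 - int hmin)"
  \<comment> \<open>Among the colors whose star has the smaller order, one of least weight serves as
    the internal color.\<close>
  have "?I \<noteq> {}" using assms(4) by (auto simp: min_def)
  then have "Min (lam ` ?I) \<in> lam ` ?I" by (intro Min_in) auto
  then obtain i where i: "i \<in> {1, 2}" "h i = hmin" "Min (lam ` ?I) = lam i" by auto
  have bound: "multiplicity_ratio lam S n \<le> ?b" for n
  proof -
    \<comment> \<open>Monotonicity passes to the even order \<open>2 * n\<close>, where the bound is
      exact rather than asymptotic. The resulting uniform bound also yields convergence.\<close>
    have "multiplicity_ratio lam S n \<le> multiplicity_ratio lam S (2 * n)"
      using inc by (auto intro: incseqD)
    also have "\<dots> \<le> lam i * real (balanced_binomial hmin (2 * n)) / real ((2 * n) choose hmin)"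
      unfolding multiplicity_ratio_def hmin
      using le[OF i(1), of "2 * n"] i(2) by (intro divide_right_mono) auto
    also have "\<dots> \<le> ?b"
      using mult_left_mono[OF balanced_binomial_ratio_even_le[of hmin n], of "lam i"] assms(2) i
      by (auto simp: less_imp_le)
    finally show ?thesis .
  qed
  \<comment> \<open>A bounded increasing sequence converges, so the \<open>lim\<close> in
    \<open>multiplicity_constant\<close> is a genuine limit and inherits the bound.\<close>
  obtain L where L: "multiplicity_ratio lam S \<longlonglongrightarrow> L"
    using incseq_convergent[OF inc] bound by blast
  then have "L \<le> ?b" using bound by (intro LIMSEQ_le_const2) auto
  moreover have "multiplicity_constant lam S = L"
    unfolding multiplicity_constant_def using L by (rule limI)
  moreover have "convergent (multiplicity_ratio lam S)" using L by (rule convergentI)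
  ultimately show ?thesis using le arg by auto
qed

end
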